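(* Let $\varphi : S \to G$ be a homomorphism of an inverse semigroup $S$ onto a group $G$ and let $H = \varphi^{-1}(1_G)$. Let $\varepsilon : \mathbb{C}S \to \mathbb{C}H$ be the restriction map $\varepsilon(\sum_{s\in S}\alpha_s s) = \sum_{h\in H}\alpha_h h$. If $H = E(S)$, or if for each $g \in G$ there is an element $s_g \in S$ such that $\varphi^{-1}(g) = s_gH$, then $\varepsilon$ is positive.
   Context: An inverse semigroup is a semigroup $S$ in which each $s$ has a unique $s^*$ with $s = ss^*s$ and $s^* = s^*ss^*$; $E(S)$ is its set of idempotents. $\mathbb{C}S$ is the complex $*$-algebra of finite formal sums over $S$, with product extending that of $S$ bilinearly and involution $(\sum \alpha_s s)^* = \sum \overline{\alpha_s}\, s^*$. An element of $\mathbb{C}S$ is positive if it is a finite sum of elements of the form $g^*g$ with $g \in \mathbb{C}S$. A map between the complex algebras of two inverse semigroups is positive if it carries positive elements to positive elements; so here $\varepsilon$ positive means that $\varepsilon$ sends positive elements of $\mathbb{C}S$ to positive elements of $\mathbb{C}H$ (finite sums of $k^*k$ with $k \in \mathbb{C}H$). $s_gH = \{s_gh : h\in H\}$. *)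

theory Defs
  imports "HOL-Algebra.Coset" "HOL-Library.Poly_Mapping" Complex_Main
begin

text \<open>
  Semigroups are carried by HOL-Algebra's \<open>monoid\<close> record so that \<open>carrier\<close>, \<open>\<otimes>\<close>, \<^const>\<open>hom\<close> and
  \<^const>\<open>l_coset\<close> can be used; the field \<open>one\<close> is never referred to, so no identity is assumed.
\<close>

locale inverse_semigroup =
  fixes S (structure)
  assumes m_closed: "\<lbrakk>x \<in> carrier S; y \<in> carrier S\<rbrakk> \<Longrightarrow> x \<otimes> y \<in> carrier S"
    and m_assoc: "\<lbrakk>x \<in> carrier S; y \<in> carrier S; z \<in> carrier S\<rbrakk>
      \<Longrightarrow> (x \<otimes> y) \<otimes> z = x \<otimes> (y \<otimes> z)"
    and ex1_star: "s \<in> carrier S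
      \<Longrightarrow> \<exists>!t. t \<in> carrier S \<and> s = s \<otimes> t \<otimes> s \<and> t = t \<otimes> s \<otimes> t"

definition star :: "('s, 'm) monoid_scheme \<Rightarrow> 's \<Rightarrow> 's" where
  "star S s = (THE t. t \<in> carrier S \<and> s = s \<otimes>\<^bsub>S\<^esub> t \<otimes>\<^bsub>S\<^esub> s \<and> t = t \<otimes>\<^bsub>S\<^esub> s \<otimes>\<^bsub>S\<^esub> t)"

definition idempotents :: "('s, 'm) monoid_scheme \<Rightarrow> 's set" where
  "idempotents S = {e \<in> carrier S. e \<otimes>\<^bsub>S\<^esub> e = e}"

text \<open>
  Elements of the semigroup algebra are finitely supported coefficient functions. The
  multiplication that \<open>Poly_Mapping\<close> provides is convolution over an additive monoid on the whole
  type, hence the product below is defined separately; addition is the one of \<open>Poly_Mapping\<close>.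
\<close>

definition semigroup_algebra :: "('s, 'm) monoid_scheme \<Rightarrow> ('s \<Rightarrow>\<^sub>0 complex) set" where
  "semigroup_algebra S = {f. Poly_Mapping.keys f \<subseteq> carrier S}"

definition alg_mult :: "('s, 'm) monoid_scheme \<Rightarrow> ('s \<Rightarrow>\<^sub>0 complex) \<Rightarrow> ('s \<Rightarrow>\<^sub>0 complex) \<Rightarrow> ('s \<Rightarrow>\<^sub>0 complex)"
  where "alg_mult S f g =
    (\<Sum>s\<in>Poly_Mapping.keys f. \<Sum>t\<in>Poly_Mapping.keys g.
       Poly_Mapping.single (s \<otimes>\<^bsub>S\<^esub> t) (Poly_Mapping.lookup f s * Poly_Mapping.lookup g t))"

definition alg_star :: "('s, 'm) monoid_scheme \<Rightarrow> ('s \<Rightarrow>\<^sub>0 complex) \<Rightarrow> ('s \<Rightarrow>\<^sub>0 complex)" where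
  "alg_star S f =
    (\<Sum>s\<in>Poly_Mapping.keys f. Poly_Mapping.single (star S s) (cnj (Poly_Mapping.lookup f s)))"

definition positive_element :: "('s, 'm) monoid_scheme \<Rightarrow> ('s \<Rightarrow>\<^sub>0 complex) \<Rightarrow> bool" where
  "positive_element S a \<longleftrightarrow>
    (\<exists>gs. set gs \<subseteq> semigroup_algebra S \<and> a = (\<Sum>g\<leftarrow>gs. alg_mult S (alg_star S g) g))"

definition positive_map ::
  "('s, 'm) monoid_scheme \<Rightarrow> ('t, 'n) monoid_scheme \<Rightarrow> (('s \<Rightarrow>\<^sub>0 complex) \<Rightarrow> ('t \<Rightarrow>\<^sub>0 complex)) \<Rightarrow> bool"
  where "positive_map S T F \<longleftrightarrow>
    F \<in> semigroup_algebra S \<rightarrow> semigroup_algebra T \<and>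
    (\<forall>a. positive_element S a \<longrightarrow> positive_element T (F a))"

definition restriction :: "'s set \<Rightarrow> ('s \<Rightarrow>\<^sub>0 complex) \<Rightarrow> ('s \<Rightarrow>\<^sub>0 complex)" where
  "restriction H f =
    (\<Sum>h\<in>Poly_Mapping.keys f \<inter> H. Poly_Mapping.single h (Poly_Mapping.lookup f h))"

text \<open>
  The kernel \<open>H\<close> is an inverse semigroup under the operation of \<open>S\<close>, and its involution is the
  restriction of that of \<open>S\<close>; so \<open>S\<lparr>carrier := H\<rparr>\<close> gives the intended algebra of \<open>H\<close>.
\<close>

lemma (in inverse_semigroup) star_props:
  assumes "s \<in> carrier S"
  shows "star S s \<in> carrier S" "s = s \<otimes> star S s \<otimes> s" "star S s = star S s \<otimes> s \<otimes> star S s"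
  using theI'[OF ex1_star[OF assms]] unfolding star_def by blast+

lemma
  fixes S (structure) and G (structure)
  assumes S: "inverse_semigroup S" and G: "group G" and hom: "\<phi> \<in> hom S G"
    and H: "H = {s \<in> carrier S. \<phi> s = \<one>\<^bsub>G\<^esub>}"
  shows kernel_inverse_semigroup: "inverse_semigroup (S\<lparr>carrier := H\<rparr>)"
    and kernel_star: "h \<in> H \<Longrightarrow> star (S\<lparr>carrier := H\<rparr>) h = star S h"
proof -
  interpret S: inverse_semigroup S by (fact S)
  interpret G: group G by (fact G)
  have star_H: "star S h \<in> H" if "h \<in> H" for h
  proof -
    have h: "h \<in> carrier S" "\<phi> h = \<one>\<^bsub>G\<^esub>" using that H by auto
    note p = S.star_props[OF h(1)]
    have "\<phi> (star S h) \<in> carrier G" using hom p(1) by (auto simp: hom_def)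
    moreover have "\<phi> h = \<phi> h \<otimes>\<^bsub>G\<^esub> \<phi> (star S h) \<otimes>\<^bsub>G\<^esub> \<phi> h"
      using hom_mult[OF hom] S.m_closed p(1,2) h(1) by metis
    ultimately have "\<phi> (star S h) = \<one>\<^bsub>G\<^esub>" using h(2) by simp
    then show ?thesis using p(1) H by simp
  qed
  have uniq: "t = star S h"
    if "h \<in> H" "t \<in> H" "h = h \<otimes> t \<otimes> h" "t = t \<otimes> h \<otimes> t" for h t
    using that S.star_props[of h] S.ex1_star[of h] H by blast
  have ex1: "\<exists>!t. t \<in> H \<and> h = h \<otimes> t \<otimes> h \<and> t = t \<otimes> h \<otimes> t" if "h \<in> H" for h
    using star_H[OF that] S.star_props[of h] uniq that H by blast
  show "inverse_semigroup (S\<lparr>carrier := H\<rparr>)"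
  proof
    fix x y assume "x \<in> carrier (S\<lparr>carrier := H\<rparr>)" "y \<in> carrier (S\<lparr>carrier := H\<rparr>)"
    then show "x \<otimes>\<^bsub>S\<lparr>carrier := H\<rparr>\<^esub> y \<in> carrier (S\<lparr>carrier := H\<rparr>)"
      using hom_mult[OF hom] H S.m_closed by simp
  qed (use H S.m_assoc ex1 in auto)
  show "star (S\<lparr>carrier := H\<rparr>) h = star S h" if "h \<in> H"
    unfolding star_def[of "S\<lparr>carrier := H\<rparr>"]
    by (rule the_equality) (use that star_H S.star_props[of h] uniq H in auto)
qed

end

theory Submission
  imports Defs
begin

text \<open>
  Write \<open>f = (\<Sum>g. f\<^sub>g)\<close> with \<open>f\<^sub>g\<close> supported on the fibre of \<open>g\<close>. Since \<open>s\<^sup>*t\<close> lies in \<open>H\<close> exactly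
  when \<open>s\<close> and \<open>t\<close> lie in the same fibre, \<open>\<epsilon>(f\<^sup>*f) = (\<Sum>g. f\<^sub>g\<^sup>*f\<^sub>g)\<close>. Each \<open>f\<^sub>g\<^sup>*f\<^sub>g\<close> is of the form \<open>k\<^sup>*k\<close>
  with \<open>k\<close> supported on \<open>H\<close>, because there is a map \<open>\<psi>\<close> from the fibre to \<open>H\<close> with
  \<open>s\<^sup>*t = \<psi>(s)\<^sup>*\<psi>(t)\<close>: take \<open>\<psi>(s) = s\<^sup>*s\<close> if \<open>H = E(S)\<close>, and \<open>\<psi>(s) = s\<^sub>g\<^sup>*s\<close> if the fibre is \<open>s\<^sub>gH\<close>.
\<close>

section \<open>Inverse semigroups\<close>

context inverse_semigroup
begin

lemmas star_closed = star_props(1)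

text \<open>Later stars are computed by naming a candidate and checking the two defining
  equations.\<close>

lemma star_unique:
  assumes "s \<in> carrier S" "t \<in> carrier S" "s \<otimes> t \<otimes> s = s" "t \<otimes> s \<otimes> t = t"
  shows "star S s = t"
  unfolding star_def by (rule the1_equality[OF ex1_star]) (simp_all add: assms)

lemma star_star: "s \<in> carrier S \<Longrightarrow> star S (star S s) = s"
  by (rule star_unique) (simp_all only: star_closed star_props(2,3)[symmetric])

lemma star_idempotent: "\<lbrakk>e \<in> carrier S; e \<otimes> e = e\<rbrakk> \<Longrightarrow> star S e = e"
  by (rule star_unique) simp_all

text \<open>With x the star of e f, the element f x e also solves the equations for an inverse of e
  f, so x = f x e. This form makes x idempotent, hence its own star, and e f = x follows by taking
  stars.\<close>

lemma idempotent_mult_idempotent: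
  assumes e: "e \<in> carrier S" "e \<otimes> e = e" and f: "f \<in> carrier S" "f \<otimes> f = f"
  shows "(e \<otimes> f) \<otimes> (e \<otimes> f) = e \<otimes> f"
proof -
  \<comment> \<open>Right-nested absorption laws: once \<open>m_assoc\<close> has moved brackets to
    the right, e e no longer appears as a subterm. \<open>x2'\<close> below plays the same part for
    \<open>x2\<close>.\<close>
  have eef: "e \<otimes> (e \<otimes> x) = e \<otimes> x" and ffx: "f \<otimes> (f \<otimes> x) = f \<otimes> x" if "x \<in> carrier S" for x
    using m_assoc[of e e x] m_assoc[of f f x] e f that by simp_all
  define x where "x = star S (e \<otimes> f)"
  have ef: "e \<otimes> f \<in> carrier S" using e f m_closed by simp
  have x: "x \<in> carrier S" unfolding x_def using star_closed ef by simp
  have x1: "e \<otimes> (f \<otimes> (x \<otimes> (e \<otimes> f))) = e \<otimes> f" and x2: "x \<otimes> (e \<otimes> (f \<otimes> x)) = x"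
    using star_props(2,3)[OF ef, folded x_def] e(1) f(1) x by (simp_all add: m_assoc m_closed)
  have x2': "x \<otimes> (e \<otimes> (f \<otimes> (x \<otimes> y))) = x \<otimes> y" if "y \<in> carrier S" for y
    using arg_cong[OF x2, of "\<lambda>z. z \<otimes> y"] that x e(1) f(1) by (simp add: m_assoc m_closed)
  have "star S (e \<otimes> f) = f \<otimes> x \<otimes> e"
    by (rule star_unique) (use e f x in \<open>simp_all add: m_assoc m_closed eef ffx x1 x2'\<close>)
  then have xeq: "x = f \<otimes> (x \<otimes> e)" using x_def e f x by (simp add: m_assoc)
  \<comment> \<open>\<open>xeq\<close> has x on both sides and would loop as a rewrite rule, so it
    is applied once to each factor.\<close>
  have "x \<otimes> x = (f \<otimes> (x \<otimes> e)) \<otimes> (f \<otimes> (x \<otimes> e))" using arg_cong2[OF xeq xeq, of "(\<otimes>)"] .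
  also have "\<dots> = f \<otimes> (x \<otimes> e)" using e(1) f(1) x by (simp add: m_assoc m_closed x2')
  also have "\<dots> = x" by (rule xeq[symmetric])
  finally have xx: "x \<otimes> x = x" .
  have "x = e \<otimes> f"
    using star_idempotent[OF x xx] star_star[OF ef] unfolding x_def by simp
  with xx show ?thesis by simp
qed

text \<open>Both e f and f e are inverses of e f, because e f and f e are idempotent; uniqueness
  identifies them.\<close>

lemma idempotents_commute:
  assumes e: "e \<in> carrier S" "e \<otimes> e = e" and f: "f \<in> carrier S" "f \<otimes> f = f"
  shows "e \<otimes> f = f \<otimes> e"
proof -
  have eef: "e \<otimes> (e \<otimes> x) = e \<otimes> x" and ffx: "f \<otimes> (f \<otimes> x) = f \<otimes> x" if "x \<in> carrier S" for x
    using m_assoc[of e e x] m_assoc[of f f x] e f that by simp_all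
  note ef = idempotent_mult_idempotent[OF e f] and fe = idempotent_mult_idempotent[OF f e]
  have "star S (e \<otimes> f) = e \<otimes> f" using e f ef m_closed by (simp add: star_idempotent)
  moreover have "star S (e \<otimes> f) = f \<otimes> e"
    by (rule star_unique) (use e f ef fe in \<open>simp_all add: m_assoc m_closed eef ffx\<close>)
  ultimately show ?thesis by simp
qed

lemma star_mult_idempotent:
  assumes "s \<in> carrier S"
  shows "(star S s \<otimes> s) \<otimes> (star S s \<otimes> s) = star S s \<otimes> s"
    and "(s \<otimes> star S s) \<otimes> (s \<otimes> star S s) = s \<otimes> star S s"
proof -
  note cl = assms star_closed[OF assms] m_closed
  have "(star S s \<otimes> s) \<otimes> (star S s \<otimes> s) = (star S s \<otimes> s \<otimes> star S s) \<otimes> s"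
    by (simp add: m_assoc cl)
  then show "(star S s \<otimes> s) \<otimes> (star S s \<otimes> s) = star S s \<otimes> s"
    by (simp only: star_props(3)[OF assms, symmetric])
  have "(s \<otimes> star S s) \<otimes> (s \<otimes> star S s) = (s \<otimes> star S s \<otimes> s) \<otimes> star S s"
    by (simp add: m_assoc cl)
  then show "(s \<otimes> star S s) \<otimes> (s \<otimes> star S s) = s \<otimes> star S s"
    by (simp only: star_props(2)[OF assms, symmetric])
qed

text \<open>The idempotents t t* and s* s commute; swapping them inside the products isolates s s* s
  and t t* t, or the starred versions.\<close>

lemma star_mult:
  assumes s: "s \<in> carrier S" and t: "t \<in> carrier S"
  shows "star S (s \<otimes> t) = star S t \<otimes> star S s"
proof (rule star_unique)
  let ?s = "star S s" and ?t = "star S t"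
  note cl = s t star_closed[OF s] star_closed[OF t] m_closed
  have comm: "(t \<otimes> ?t) \<otimes> (?s \<otimes> s) = (?s \<otimes> s) \<otimes> (t \<otimes> ?t)"
    by (rule idempotents_commute) (simp_all add: cl star_mult_idempotent)
  have "s \<otimes> t \<otimes> (?t \<otimes> ?s) \<otimes> (s \<otimes> t) = s \<otimes> ((t \<otimes> ?t) \<otimes> (?s \<otimes> s)) \<otimes> t"
    by (simp add: m_assoc cl)
  also have "\<dots> = (s \<otimes> ?s \<otimes> s) \<otimes> (t \<otimes> ?t \<otimes> t)"
    unfolding comm by (simp add: m_assoc cl)
  finally show "s \<otimes> t \<otimes> (?t \<otimes> ?s) \<otimes> (s \<otimes> t) = s \<otimes> t"
    by (simp only: star_props(2)[OF s, symmetric] star_props(2)[OF t, symmetric])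
  have "?t \<otimes> ?s \<otimes> (s \<otimes> t) \<otimes> (?t \<otimes> ?s) = ?t \<otimes> ((?s \<otimes> s) \<otimes> (t \<otimes> ?t)) \<otimes> ?s"
    by (simp add: m_assoc cl)
  also have "\<dots> = (?t \<otimes> t \<otimes> ?t) \<otimes> (?s \<otimes> s \<otimes> ?s)"
    unfolding comm[symmetric] by (simp add: m_assoc cl)
  finally show "?t \<otimes> ?s \<otimes> (s \<otimes> t) \<otimes> (?t \<otimes> ?s) = ?t \<otimes> ?s"
    by (simp only: star_props(3)[OF s, symmetric] star_props(3)[OF t, symmetric])
qed (simp_all add: s t star_closed m_closed)

text \<open>The idempotent s t* is its own star, so s t* = t s*. Hence s* s t* t = s* t s* t, the
  square of the idempotent s* t.\<close>

lemma star_mult_compatible: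
  assumes s: "s \<in> carrier S" and t: "t \<in> carrier S"
    and l: "star S s \<otimes> t \<in> idempotents S" and r: "s \<otimes> star S t \<in> idempotents S"
  shows "star S s \<otimes> t = (star S s \<otimes> s) \<otimes> (star S t \<otimes> t)"
proof -
  let ?s = "star S s" and ?t = "star S t"
  note cl = s t star_closed[OF s] star_closed[OF t] m_closed
  have "star S (s \<otimes> ?t) = s \<otimes> ?t"
    using r by (intro star_idempotent) (simp_all add: idempotents_def)
  then have r': "s \<otimes> ?t = t \<otimes> ?s" by (simp add: star_mult star_star cl)
  have "(?s \<otimes> s) \<otimes> (?t \<otimes> t) = ?s \<otimes> (s \<otimes> ?t) \<otimes> t" by (simp add: m_assoc cl)
  also have "\<dots> = (?s \<otimes> t) \<otimes> (?s \<otimes> t)" unfolding r' by (simp add: m_assoc cl)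
  also have "\<dots> = ?s \<otimes> t" using l by (simp add: idempotents_def)
  finally show ?thesis ..
qed

end

section \<open>Semigroup algebras\<close>

lemma sum_keys_superset:
  assumes "finite A" "Poly_Mapping.keys f \<subseteq> A" "\<And>s. F s 0 = 0"
  shows "(\<Sum>s\<in>Poly_Mapping.keys f. F s (Poly_Mapping.lookup f s))
    = (\<Sum>s\<in>A. F s (Poly_Mapping.lookup f s))"
  using assms by (intro sum.mono_neutral_left) (auto simp: in_keys_iff)

text \<open>Cancellation can shrink the support of f + g, so all three sums are first extended to
  the union of the supports of f and g; the added terms vanish.\<close>

lemma sum_keys_add:
  fixes F :: "'s \<Rightarrow> 'c::comm_monoid_add \<Rightarrow> 'd::comm_monoid_add"
  assumes "\<And>s. F s 0 = 0" "\<And>s a b. F s (a + b) = F s a + F s b"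
  shows "(\<Sum>s\<in>Poly_Mapping.keys (f + g). F s (Poly_Mapping.lookup (f + g) s)) =
    (\<Sum>s\<in>Poly_Mapping.keys f. F s (Poly_Mapping.lookup f s))
    + (\<Sum>s\<in>Poly_Mapping.keys g. F s (Poly_Mapping.lookup g s))"
proof -
  let ?A = "Poly_Mapping.keys f \<union> Poly_Mapping.keys g"
  have *: "(\<Sum>s\<in>Poly_Mapping.keys h. F s (Poly_Mapping.lookup h s))
      = (\<Sum>s\<in>?A. F s (Poly_Mapping.lookup h s))" if "Poly_Mapping.keys h \<subseteq> ?A" for h
    using that by (intro sum_keys_superset assms(1)) simp_all
  show ?thesis
    unfolding *[OF Poly_Mapping.keys_add] *[OF Un_upper1] *[OF Un_upper2]
    by (simp add: lookup_add assms(2) sum.distrib)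
qed

text \<open>An expression additive in the coefficients can be evaluated on any presentation of f by
  singles, even one with repeated points or zero coefficients. This frees the involution and the
  product from the actual support.\<close>

lemma sum_keys_sum_single:
  fixes F :: "'s \<Rightarrow> 'c::comm_monoid_add \<Rightarrow> 'd::comm_monoid_add"
  assumes "\<And>s. F s 0 = 0" "\<And>s a b. F s (a + b) = F s a + F s b"
    and f: "f = (\<Sum>i\<in>A. Poly_Mapping.single (x i) (c i))"
  shows "(\<Sum>s\<in>Poly_Mapping.keys f. F s (Poly_Mapping.lookup f s)) = (\<Sum>i\<in>A. F (x i) (c i))"
  unfolding f
proof (induction A rule: infinite_finite_induct)
  case (insert i A)
  \<comment> \<open>For \<open>c i = 0\<close> the support is empty, and both sides are 0 because
    \<open>F s 0 = 0\<close>.\<close>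
  have "(\<Sum>s\<in>Poly_Mapping.keys (Poly_Mapping.single (x i) (c i)).
      F s (Poly_Mapping.lookup (Poly_Mapping.single (x i) (c i)) s)) = F (x i) (c i)"
    by (simp add: assms(1))
  with insert show ?case by (simp add: sum_keys_add[of F, OF assms(1,2)])
qed simp_all

lemma poly_mapping_sum_singles:
  "f = (\<Sum>s\<in>Poly_Mapping.keys f. Poly_Mapping.single s (Poly_Mapping.lookup f s))"
  by (rule poly_mapping_eqI)
    (auto simp: lookup_sum lookup_single when_def in_keys_iff sum.delta)

lemma alg_star_sum_single:
  "alg_star S (\<Sum>i\<in>A. Poly_Mapping.single (x i) (c i))
    = (\<Sum>i\<in>A. Poly_Mapping.single (star S (x i)) (cnj (c i)))"
  unfolding alg_star_def
  by (rule sum_keys_sum_single[where F = "\<lambda>s a. Poly_Mapping.single (star S s) (cnj a)"])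
    (simp_all add: single_add)

text \<open>The product is additive in each factor separately: the left factor is expanded with the
  right one fixed, then the right one.\<close>

lemma alg_mult_sum_single:
  fixes S (structure)
  shows "alg_mult S (\<Sum>i\<in>A. Poly_Mapping.single (x i) (c i)) (\<Sum>j\<in>B. Poly_Mapping.single (y j) (d j))
    = (\<Sum>i\<in>A. \<Sum>j\<in>B. Poly_Mapping.single (x i \<otimes> y j) (c i * d j))" (is "alg_mult S ?f ?g = _")
proof -
  have "alg_mult S ?f ?g = (\<Sum>i\<in>A. \<Sum>t\<in>Poly_Mapping.keys ?g.
      Poly_Mapping.single (x i \<otimes> t) (c i * Poly_Mapping.lookup ?g t))"
    unfolding alg_mult_def
    by (rule sum_keys_sum_single[where F = "\<lambda>s a. \<Sum>t\<in>Poly_Mapping.keys ?g.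
        Poly_Mapping.single (s \<otimes> t) (a * Poly_Mapping.lookup ?g t)"])
      (simp_all add: single_add distrib_right sum.distrib)
  also have "\<dots> = (\<Sum>i\<in>A. \<Sum>j\<in>B. Poly_Mapping.single (x i \<otimes> y j) (c i * d j))"
    by (intro sum.cong refl
        sum_keys_sum_single[where F = "\<lambda>t b. Poly_Mapping.single (x _ \<otimes> t) (c _ * b)"])
      (simp_all add: single_add distrib_left)
  finally show ?thesis .
qed

text \<open>Used with two presentations: the canonical one over the support of f, and one along a
  map \<psi> that may identify points.\<close>

lemma alg_star_mult_sum_single:
  fixes S (structure)
  assumes "f = (\<Sum>i\<in>A. Poly_Mapping.single (x i) (c i))"
  shows "alg_mult S (alg_star S f) f
    = (\<Sum>i\<in>A. \<Sum>j\<in>A. Poly_Mapping.single (star S (x i) \<otimes> x j) (cnj (c i) * c j))"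
  unfolding assms alg_star_sum_single by (rule alg_mult_sum_single)

section \<open>Additivity of the restriction map\<close>

lemma restriction_eq_sum:
  "restriction H f = (\<Sum>s\<in>Poly_Mapping.keys f.
     if s \<in> H then Poly_Mapping.single s (Poly_Mapping.lookup f s) else 0)"
  unfolding restriction_def by (simp add: sum.inter_restrict)

text \<open>In the form \<open>restriction_eq_sum\<close> the summand is additive in the
  coefficient, so \<open>sum_keys_add\<close> applies.\<close>

lemma restriction_add: "restriction H (f + g) = restriction H f + restriction H g"
  unfolding restriction_eq_sum
  by (rule sum_keys_add[where F = "\<lambda>s a. if s \<in> H then Poly_Mapping.single s a else 0"])
    (simp_all add: single_add)

lemma restriction_zero: "restriction H 0 = 0"
  by (simp add: restriction_def)

lemma restriction_sum: "restriction H (\<Sum>i\<in>A. f i) = (\<Sum>i\<in>A. restriction H (f i))"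
  by (induction A rule: infinite_finite_induct) (simp_all add: restriction_zero restriction_add)

lemma restriction_sum_list: "restriction H (\<Sum>i\<leftarrow>xs. f i) = (\<Sum>i\<leftarrow>xs. restriction H (f i))"
  by (induction xs) (simp_all add: restriction_zero restriction_add)

lemma restriction_single:
  "restriction H (Poly_Mapping.single s a) = (if s \<in> H then Poly_Mapping.single s a else 0)"
  by (simp add: restriction_eq_sum)

lemma sum_single_in_semigroup_algebra:
  assumes "\<And>i. i \<in> A \<Longrightarrow> x i \<in> carrier S"
  shows "(\<Sum>i\<in>A. Poly_Mapping.single (x i) (c i)) \<in> semigroup_algebra S"
  using keys_sum[of "\<lambda>i. Poly_Mapping.single (x i) (c i)" A] assms
  by (fastforce simp: semigroup_algebra_def split: if_splits)

lemma restriction_in_semigroup_algebra: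
  "restriction (carrier S) f \<in> semigroup_algebra S"
  unfolding restriction_def by (rule sum_single_in_semigroup_algebra) simp

section \<open>Closure of positive elements under sums\<close>

lemma positive_element_zero: "positive_element S 0"
  unfolding positive_element_def by (rule exI[of _ "[]"]) simp

lemma positive_element_square:
  "f \<in> semigroup_algebra S \<Longrightarrow> positive_element S (alg_mult S (alg_star S f) f)"
  unfolding positive_element_def by (rule exI[of _ "[f]"]) simp

lemma positive_element_add:
  assumes "positive_element S a" "positive_element S b"
  shows "positive_element S (a + b)"
proof -
  from assms obtain gs hs where
    "set gs \<subseteq> semigroup_algebra S" "a = (\<Sum>g\<leftarrow>gs. alg_mult S (alg_star S g) g)"
    "set hs \<subseteq> semigroup_algebra S" "b = (\<Sum>g\<leftarrow>hs. alg_mult S (alg_star S g) g)"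
    unfolding positive_element_def by blast
  then show ?thesis
    unfolding positive_element_def by (intro exI[of _ "gs @ hs"]) simp
qed

lemma positive_element_sum:
  "(\<And>i. i \<in> A \<Longrightarrow> positive_element S (f i)) \<Longrightarrow> positive_element S (\<Sum>i\<in>A. f i)"
  by (induction A rule: infinite_finite_induct)
    (simp_all add: positive_element_zero positive_element_add)

lemma positive_element_sum_list:
  "(\<And>i. i \<in> set xs \<Longrightarrow> positive_element S (f i)) \<Longrightarrow> positive_element S (\<Sum>i\<leftarrow>xs. f i)"
  by (induction xs) (simp_all add: positive_element_zero positive_element_add)

section \<open>Homomorphisms onto groups\<close>

locale inverse_semigroup_hom_group = S: inverse_semigroup S + G: group G
  for S :: "('s, 'm) monoid_scheme" (structure) and G :: "('g, 'n) monoid_scheme" +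
  fixes \<phi> :: "'s \<Rightarrow> 'g" and H :: "'s set"
  assumes hom: "\<phi> \<in> hom S G"
    and H_eq: "H = {s \<in> carrier S. \<phi> s = \<one>\<^bsub>G\<^esub>}"
begin

text \<open>Applying \<phi> to s = s s* s and cancelling \<phi> s in the group leaves \<phi> s times
  the image of s* equal to the identity.\<close>

lemma hom_star:
  assumes s: "s \<in> carrier S"
  shows "\<phi> (star S s) = inv\<^bsub>G\<^esub> \<phi> s"
proof -
  note cl = hom_in_carrier[OF hom s] hom_in_carrier[OF hom S.star_closed[OF s]]
  have "\<phi> s = \<phi> s \<otimes>\<^bsub>G\<^esub> \<phi> (star S s) \<otimes>\<^bsub>G\<^esub> \<phi> s"
    using S.star_props[OF s] s hom_mult[OF hom] S.m_closed by metis
  then have "\<phi> s \<otimes>\<^bsub>G\<^esub> \<phi> (star S s) = \<one>\<^bsub>G\<^esub>" using cl by (metis G.m_closed G.r_cancel_one')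
  then show ?thesis using cl by (metis G.inv_equality G.inv_inv G.inv_closed)
qed

lemma star_mult_in_H_iff:
  assumes s: "s \<in> carrier S" and t: "t \<in> carrier S"
  shows "star S s \<otimes> t \<in> H \<longleftrightarrow> \<phi> s = \<phi> t"
proof -
  note cl = hom_in_carrier[OF hom s] hom_in_carrier[OF hom t]
  have "\<phi> (star S s \<otimes> t) = inv\<^bsub>G\<^esub> \<phi> s \<otimes>\<^bsub>G\<^esub> \<phi> t"
    unfolding hom_mult[OF hom S.star_closed[OF s] t] hom_star[OF s] ..
  moreover have "inv\<^bsub>G\<^esub> \<phi> s \<otimes>\<^bsub>G\<^esub> \<phi> t = \<one>\<^bsub>G\<^esub> \<longleftrightarrow> \<phi> s = \<phi> t"
  proof
    assume "inv\<^bsub>G\<^esub> \<phi> s \<otimes>\<^bsub>G\<^esub> \<phi> t = \<one>\<^bsub>G\<^esub>"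
    then have "inv\<^bsub>G\<^esub> \<phi> t = inv\<^bsub>G\<^esub> \<phi> s"
      using cl by (intro G.inv_equality) simp_all
    then show "\<phi> s = \<phi> t" using cl by (simp add: G.inv_inj[THEN inj_on_eq_iff])
  qed (use cl in simp)
  ultimately show ?thesis
    using S.m_closed[OF S.star_closed[OF s] t] by (simp only: H_eq mem_Collect_eq simp_thms)
qed

text \<open>The square root k is obtained by moving each coefficient c s to the point \<psi> s of H.
  Expanding k* k along this presentation, without merging coinciding points, and applying
  \<open>eq\<close> termwise gives the stated sum.\<close>

lemma fibre_square:
  assumes A: "A \<subseteq> carrier S" and \<psi>: "\<And>s. s \<in> A \<Longrightarrow> \<psi> s \<in> H"
    and eq: "\<And>s t. \<lbrakk>s \<in> A; t \<in> A\<rbrakk> \<Longrightarrow> star S s \<otimes> t = star S (\<psi> s) \<otimes> \<psi> t"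
  shows "positive_element (S\<lparr>carrier := H\<rparr>)
    (\<Sum>s\<in>A. \<Sum>t\<in>A. Poly_Mapping.single (star S s \<otimes> t) (cnj (c s) * c t))"
proof -
  define k where "k = (\<Sum>s\<in>A. Poly_Mapping.single (\<psi> s) (c s))"
  let ?SH = "S\<lparr>carrier := H\<rparr>"
  have "k \<in> semigroup_algebra ?SH"
    unfolding k_def using \<psi> by (intro sum_single_in_semigroup_algebra) simp
  \<comment> \<open>The square must be formed in the algebra of H, while \<open>eq\<close> speaks of
    stars in S; the two stars agree on H.\<close>
  moreover have "star ?SH (\<psi> s) = star S (\<psi> s)" if "s \<in> A" for s
    using kernel_star[OF S.inverse_semigroup_axioms G.group_axioms hom H_eq \<psi>[OF that]] .
  then have "alg_mult ?SH (alg_star ?SH k) k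
      = (\<Sum>s\<in>A. \<Sum>t\<in>A. Poly_Mapping.single (star S s \<otimes> t) (cnj (c s) * c t))"
    unfolding alg_star_mult_sum_single[OF k_def] by (simp add: eq)
  ultimately show ?thesis using positive_element_square by metis
qed

text \<open>Expand over pairs s, t of the support of f: by \<open>star_mult_in_H_iff\<close> only
  pairs in a common fibre survive, so the double sum splits into diagonal blocks.\<close>

lemma restriction_square:
  assumes f: "f \<in> semigroup_algebra S"
  shows "restriction H (alg_mult S (alg_star S f) f) =
    (\<Sum>g\<in>\<phi> ` Poly_Mapping.keys f.
       \<Sum>s\<in>{s \<in> Poly_Mapping.keys f. \<phi> s = g}. \<Sum>t\<in>{s \<in> Poly_Mapping.keys f. \<phi> s = g}.
         Poly_Mapping.single (star S s \<otimes> t)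
           (cnj (Poly_Mapping.lookup f s) * Poly_Mapping.lookup f t))"
proof -
  let ?K = "Poly_Mapping.keys f"
  let ?p = "\<lambda>s t. Poly_Mapping.single (star S s \<otimes> t)
    (cnj (Poly_Mapping.lookup f s) * Poly_Mapping.lookup f t)"
  have K: "?K \<subseteq> carrier S" using f by (simp add: semigroup_algebra_def)
  have "restriction H (alg_mult S (alg_star S f) f)
      = (\<Sum>s\<in>?K. \<Sum>t\<in>?K. restriction H (?p s t))"
    unfolding alg_star_mult_sum_single[OF poly_mapping_sum_singles] restriction_sum ..
  also have "\<dots> = (\<Sum>s\<in>?K. \<Sum>t\<in>?K. if \<phi> t = \<phi> s then ?p s t else 0)"
    using K by (intro sum.cong refl) (auto simp: restriction_single star_mult_in_H_iff subset_iff)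
  also have "\<dots> = (\<Sum>s\<in>?K. \<Sum>t\<in>{t \<in> ?K. \<phi> t = \<phi> s}. ?p s t)"
    by (simp add: sum.inter_filter)
  \<comment> \<open>The outer sum is grouped by the value of \<phi>. The inner index set depends on
    s only through \<phi> s, so it is constant on each block.\<close>
  also have "\<dots> = (\<Sum>g\<in>\<phi> ` ?K. \<Sum>s\<in>{s \<in> ?K. \<phi> s = g}. \<Sum>t\<in>{t \<in> ?K. \<phi> t = \<phi> s}. ?p s t)"
    by (rule sum.image_gen) simp
  also have "\<dots> = (\<Sum>g\<in>\<phi> ` ?K. \<Sum>s\<in>{s \<in> ?K. \<phi> s = g}. \<Sum>t\<in>{t \<in> ?K. \<phi> t = g}. ?p s t)"
    by (intro sum.cong refl) auto
  finally show ?thesis .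
qed

text \<open>Reduces both cases to finding, for each g separately, a suitable \<psi> on the fibre:
  each diagonal block is then positive by \<open>fibre_square\<close>, and additivity passes from
  one square to a sum of squares.\<close>

lemma restriction_positive:
  assumes "\<And>g. g \<in> carrier G \<Longrightarrow> \<exists>\<psi>. \<forall>s \<in> carrier S. \<phi> s = g \<longrightarrow> \<psi> s \<in> H \<and>
    (\<forall>t \<in> carrier S. \<phi> t = g \<longrightarrow> star S s \<otimes> t = star S (\<psi> s) \<otimes> \<psi> t)"
  shows "positive_map S (S\<lparr>carrier := H\<rparr>) (restriction H)"
proof -
  have square: "positive_element (S\<lparr>carrier := H\<rparr>) (restriction H (alg_mult S (alg_star S f) f))"
    if f: "f \<in> semigroup_algebra S" for f
    unfolding restriction_square[OF f]
  proof (rule positive_element_sum)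
    fix g assume g: "g \<in> \<phi> ` Poly_Mapping.keys f"
    have K: "Poly_Mapping.keys f \<subseteq> carrier S" using f by (simp add: semigroup_algebra_def)
    then have "g \<in> carrier G" using g hom_in_carrier[OF hom] by blast
    from assms[OF this] obtain \<psi> where \<psi>: "\<And>s. \<lbrakk>s \<in> carrier S; \<phi> s = g\<rbrakk> \<Longrightarrow> \<psi> s \<in> H"
      "\<And>s t. \<lbrakk>s \<in> carrier S; \<phi> s = g; t \<in> carrier S; \<phi> t = g\<rbrakk>
        \<Longrightarrow> star S s \<otimes> t = star S (\<psi> s) \<otimes> \<psi> t"
      by blast
    show "positive_element (S\<lparr>carrier := H\<rparr>)
      (\<Sum>s\<in>{s \<in> Poly_Mapping.keys f. \<phi> s = g}. \<Sum>t\<in>{s \<in> Poly_Mapping.keys f. \<phi> s = g}.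
         Poly_Mapping.single (star S s \<otimes> t)
           (cnj (Poly_Mapping.lookup f s) * Poly_Mapping.lookup f t))"
      by (rule fibre_square[of _ \<psi>]) (use K in \<open>auto intro: \<psi>(1) intro!: \<psi>(2)\<close>)
  qed
  have "positive_element (S\<lparr>carrier := H\<rparr>) (restriction H a)" if "positive_element S a" for a
  proof -
    from that obtain gs where gs: "set gs \<subseteq> semigroup_algebra S"
      and a: "a = (\<Sum>g\<leftarrow>gs. alg_mult S (alg_star S g) g)"
      unfolding positive_element_def by blast
    show ?thesis
      unfolding a restriction_sum_list using gs square by (intro positive_element_sum_list) blast
  qed
  \<comment> \<open>The carrier of \<open>S\<lparr>carrier := H\<rparr>\<close> is H, which gives
    the codomain condition of \<open>positive_map\<close>.\<close>
  then show ?thesis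
    using restriction_in_semigroup_algebra[of "S\<lparr>carrier := H\<rparr>"] by (simp add: positive_map_def)
qed

text \<open>For s and t in one fibre, both s* t and s t* lie in the kernel, hence are idempotent,
  and \<open>star_mult_compatible\<close> applies. The idempotent s* s is its own star.\<close>

lemma fibre_map_idempotents:
  assumes HE: "H = idempotents S"
    and s: "s \<in> carrier S" and t: "t \<in> carrier S" and st: "\<phi> s = \<phi> t"
  shows "star S s \<otimes> t = star S (star S s \<otimes> s) \<otimes> (star S t \<otimes> t)"
proof -
  have "\<phi> (s \<otimes> star S t) = \<one>\<^bsub>G\<^esub>"
    using hom_mult[OF hom s S.star_closed[OF t]] hom_star[OF t] hom_in_carrier[OF hom t] st by simp
  then have "s \<otimes> star S t \<in> idempotents S"
    unfolding HE[symmetric] using s t S.star_closed S.m_closed by (simp add: H_eq)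
  moreover have "star S s \<otimes> t \<in> idempotents S"
    unfolding HE[symmetric] using star_mult_in_H_iff[OF s t] st by simp
  moreover have "star S (star S s \<otimes> s) = star S s \<otimes> s"
    using s S.star_closed S.m_closed S.star_mult_idempotent by (simp add: S.star_idempotent)
  ultimately show ?thesis using S.star_mult_compatible[OF s t] by simp
qed

text \<open>The right side equals s* x x* t, and the idempotent x x* fixes t because t = x
  h.\<close>

lemma fibre_map_coset:
  assumes x: "x \<in> carrier S" and s: "s \<in> carrier S" and t: "t \<in> x <# H"
  shows "star S s \<otimes> t = star S (star S x \<otimes> s) \<otimes> (star S x \<otimes> t)"
proof -
  from t obtain h where h: "h \<in> carrier S" and th: "t = x \<otimes> h"
    by (auto simp: l_coset_def H_eq)
  note cl = x s h S.star_closed[OF x] S.star_closed[OF s] S.m_closed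
  have "star S (star S x \<otimes> s) \<otimes> (star S x \<otimes> t) = star S s \<otimes> ((x \<otimes> star S x \<otimes> x) \<otimes> h)"
    by (simp add: th S.star_mult S.star_star S.m_assoc cl)
  then show ?thesis by (simp only: th S.star_props(2)[OF x, symmetric])
qed

end

theorem proposition6p3:
  fixes S :: "('s, 'm) monoid_scheme" and G :: "('g, 'n) monoid_scheme"
    and \<phi> :: "'s \<Rightarrow> 'g" and H :: "'s set"
  assumes "inverse_semigroup S"
    and "group G"
    and "\<phi> \<in> hom S G"
    and "\<phi> ` carrier S = carrier G"
    and "H = {s \<in> carrier S. \<phi> s = \<one>\<^bsub>G\<^esub>}"
    and "H = idempotents S \<or>
      (\<forall>g \<in> carrier G. \<exists>s\<^sub>g \<in> carrier S. {s \<in> carrier S. \<phi> s = g} = s\<^sub>g <#\<^bsub>S\<^esub> H)"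
  shows "positive_map S (S\<lparr>carrier := H\<rparr>) (restriction H)"
proof -
  interpret inverse_semigroup_hom_group S G \<phi> H
    using assms(1,2,3,5) by (intro inverse_semigroup_hom_group.intro inverse_semigroup_hom_group_axioms.intro)
  show ?thesis
    using assms(6)
  proof
    assume HE: "H = idempotents S"
    show ?thesis
    proof (rule restriction_positive)
      fix g assume "g \<in> carrier G"
      show "\<exists>\<psi>. \<forall>s \<in> carrier S. \<phi> s = g \<longrightarrow> \<psi> s \<in> H \<and> (\<forall>t \<in> carrier S. \<phi> t = g \<longrightarrow>
          star S s \<otimes>\<^bsub>S\<^esub> t = star S (\<psi> s) \<otimes>\<^bsub>S\<^esub> \<psi> t)"
        \<comment> \<open>Membership of s* s in H is \<open>star_mult_in_H_iff\<close> with both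
          arguments equal to s.\<close>
        by (rule exI[of _ "\<lambda>s. star S s \<otimes>\<^bsub>S\<^esub> s"])
          (intro ballI impI conjI fibre_map_idempotents[OF HE], simp_all add: star_mult_in_H_iff)
    qed
  next
    assume coset: "\<forall>g \<in> carrier G. \<exists>x \<in> carrier S. {s \<in> carrier S. \<phi> s = g} = x <#\<^bsub>S\<^esub> H"
    show ?thesis
    proof (rule restriction_positive)
      fix g assume g: "g \<in> carrier G"
      obtain x where x: "x \<in> carrier S" "{s \<in> carrier S. \<phi> s = g} = x <#\<^bsub>S\<^esub> H"
        using bspec[OF coset g] by (elim bexE)
      \<comment> \<open>The coset equation does not directly place x in the fibre. Surjectivity
        supplies some s there; writing s = x h with h in the kernel gives \<phi> x = \<phi> s. This
        is what puts x* s into H for every s in the fibre.\<close>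
      have "\<phi> x = g"
      proof -
        obtain s where s: "s \<in> carrier S" "\<phi> s = g" using g[folded assms(4)] by (elim imageE) simp
        then have "s \<in> x <#\<^bsub>S\<^esub> H" unfolding x(2)[symmetric] by simp
        then obtain h where h: "h \<in> carrier S" "\<phi> h = \<one>\<^bsub>G\<^esub>" "s = x \<otimes>\<^bsub>S\<^esub> h"
          unfolding l_coset_def by (auto simp: H_eq)
        show ?thesis
          using s(2) hom_in_carrier[OF hom x(1)] unfolding h(3) hom_mult[OF hom x(1) h(1)] h(2)
          by simp
      qed
      then have "star S x \<otimes>\<^bsub>S\<^esub> s \<in> H" if "s \<in> carrier S" "\<phi> s = g" for s
        using star_mult_in_H_iff[OF x(1) that(1)] that(2) by simp
      moreover have "t \<in> x <#\<^bsub>S\<^esub> H" if "t \<in> carrier S" "\<phi> t = g" for t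
        unfolding x(2)[symmetric] using that by simp
      ultimately show "\<exists>\<psi>. \<forall>s \<in> carrier S. \<phi> s = g \<longrightarrow> \<psi> s \<in> H \<and> (\<forall>t \<in> carrier S. \<phi> t = g \<longrightarrow>
          star S s \<otimes>\<^bsub>S\<^esub> t = star S (\<psi> s) \<otimes>\<^bsub>S\<^esub> \<psi> t)"
        by (intro exI[of _ "\<lambda>s. star S x \<otimes>\<^bsub>S\<^esub> s"] ballI impI conjI fibre_map_coset[OF x(1)])
    qed
  qed
qed

end
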